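(* Let the angular power spectrum $(A_\ell,\ell\in\mathbb N_0)$ of the centered, isotropic Gaussian random field $T$ on $\mathbb S^2$ decay algebraically with order $\alpha>2$; that is, there exist constants $C>0$ and $\ell_0\in\mathbb N$ such that $A_\ell\le C\,\ell^{-\alpha}$ for all $\ell>\ell_0$. Then the sequence of approximate (truncated) random fields $(T^\kappa,\kappa\in\mathbb N)$ converges to $T$ $\mathbb P$-almost surely (in $L^2(\mathbb S^2)$), and for all $\beta<(\alpha-2)/2$ the truncation error is asymptotically bounded by $$\|T-T^\kappa\|_{L^2(\mathbb S^2)}\le\kappa^{-\beta},\qquad\mathbb P\text{-a.s.},$$ i.e. $\mathbb P$-almost surely this inequality holds for all sufficiently large $\kappa$ (with a random threshold).
   Context: $\mathbb S^2$ is the unit sphere in $\mathbb R^3$ with surface measure. A centered isotropic Gaussian random field on $\mathbb S^2$ is a jointly measurable Gaussian map $T:\Omega\times\mathbb S^2\to\mathbb R$ with mean zero and covariance invariant under rotations in $\mathrm{SO}(3)$; its angular power spectrum is the sequence of nonnegative reals $(A_\ell)$ with $\mathbb E(T(x)T(y))=\sum_\ell A_\ell\frac{2\ell+1}{4\pi}P_\ell(\langle x,y\rangle)$, $P_\ell$ the Legendre polynomials. Let $P_{\ell m}(\mu)=(-1)^m(1-\mu^2)^{m/2}\frac{\partial^m}{\partial\mu^m}P_\ell(\mu)$ and $L_{\ell m}(\vartheta)=\sqrt{\frac{2\ell+1}{4\pi}\frac{(\ell-m)!}{(\ell+m)!}}P_{\ell m}(\cos\vartheta)$. The field is given by its Karhunen–Loève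 series $$T(y)=\sum_{\ell=0}^\infty\Bigl(\sqrt{A_\ell}X^1_{\ell0}L_{\ell0}(\vartheta)+\sqrt{2A_\ell}\sum_{m=1}^\ell L_{\ell m}(\vartheta)\bigl(X^1_{\ell m}\cos(m\varphi)+X^2_{\ell m}\sin(m\varphi)\bigr)\Bigr),$$ $y=(\sin\vartheta\cos\varphi,\sin\vartheta\sin\varphi,\cos\vartheta)$, with independent real standard normal random variables $X^1_{\ell m}$ ($0\le m\le\ell$), $X^2_{\ell m}$ ($1\le m\le\ell$). For $\kappa\in\mathbb N$, $T^\kappa$ denotes the same expression with the sum over $\ell$ restricted to $0\le\ell\le\kappa$. *)

theory Defs
  imports "HOL-Probability.Probability" "HOL-Computational_Algebra.Polynomial"
begin

section \<open>The sphere and its surface measure\<close>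

abbreviation S2 :: "(real^3) set" where
  "S2 \<equiv> sphere 0 1"

definition sph_point :: "real \<Rightarrow> real \<Rightarrow> real^3" where
  "sph_point \<theta> \<phi> = vector [sin \<theta> * cos \<phi>, sin \<theta> * sin \<phi>, cos \<theta>]"

text \<open>Spherical coordinates of a point of the sphere, with values in \<open>[0, \<pi>]\<close> and \<open>[0, 2\<pi>)\<close>.
  At the two poles the longitude is arbitrary (here \<open>0\<close>); it does not enter the
  Karhunen--Loeve terms there, as \<open>L\<^bsub>l m\<^esub>\<close> vanishes at the poles for \<open>m \<ge> 1\<close>.\<close>

definition colatitude :: "real^3 \<Rightarrow> real" where
  "colatitude y = arccos (y $ 3)"

definition longitude :: "real^3 \<Rightarrow> real" where
  "longitude y = Arg2pi (Complex (y $ 1) (y $ 2))"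

text \<open>The surface measure, i.e. \<open>sin \<theta> d\<theta> d\<phi>\<close> transported to the sphere.\<close>

definition S2_measure :: "(real^3) measure" where
  "S2_measure =
     distr (density (restrict_space lborel ({0..pi} \<times> {0..<2*pi})) (\<lambda>(\<theta>, \<phi>). ennreal (sin \<theta>)))
       (restrict_space borel S2) (\<lambda>(\<theta>, \<phi>). sph_point \<theta> \<phi>)"

lemma sph_point_in_S2: "sph_point \<theta> \<phi> \<in> S2"
proof -
  have "(sin \<theta> * cos \<phi>)\<^sup>2 + (sin \<theta> * sin \<phi>)\<^sup>2 + (cos \<theta>)\<^sup>2
      = (sin \<theta>)\<^sup>2 * ((cos \<phi>)\<^sup>2 + (sin \<phi>)\<^sup>2) + (cos \<theta>)\<^sup>2"
    by (simp only: power_mult_distrib distrib_left)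
  then have "(sin \<theta> * cos \<phi>)\<^sup>2 + (sin \<theta> * sin \<phi>)\<^sup>2 + (cos \<theta>)\<^sup>2 = 1"
    by (simp only: sin_cos_squared_add sin_cos_squared_add2 mult_1_right)
  then show ?thesis
    unfolding mem_sphere_0
    by (simp only: sph_point_def norm_vec_def L2_set_def sum_3 vector_3 real_norm_def
        power2_abs real_sqrt_one)
qed

lemma sph_point_coordinates:
  assumes "y \<in> S2"
  shows "sph_point (colatitude y) (longitude y) = y"
proof -
  let ?z = "Complex (y $ 1) (y $ 2)"
  have n: "(y$1)\<^sup>2 + (y$2)\<^sup>2 + (y$3)\<^sup>2 = 1"
    using assms by (simp add: norm_vec_def L2_set_def sum_3)
  then have "(y$3)\<^sup>2 \<le> 1"
    using zero_le_power2[of "y$1"] zero_le_power2[of "y$2"] by linarith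
  then have b: "\<bar>y$3\<bar> \<le> 1"
    by (simp only: abs_square_le_1)
  have "1 - (y$3)\<^sup>2 = (y$1)\<^sup>2 + (y$2)\<^sup>2"
    using n by linarith
  then have s: "sin (arccos (y$3)) = cmod ?z"
    using b by (simp only: sin_arccos_abs complex_norm)
  have "cmod ?z * cos (Arg2pi ?z) = y$1" "cmod ?z * sin (Arg2pi ?z) = y$2"
    by (simp_all only: cos_Arg2pi sin_Arg2pi complex.sel)
  then show ?thesis
    unfolding vec_eq_iff forall_3 sph_point_def colatitude_def longitude_def vector_3 s
    using b by (simp only: cos_arccos_abs simp_thms)
qed

lemma measurable_sph_point:
  "(\<lambda>(\<theta>, \<phi>). sph_point \<theta> \<phi>) \<in> borel \<rightarrow>\<^sub>M restrict_space borel S2"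
proof (rule measurable_restrict_space2)
  have "continuous_on UNIV (\<lambda>p. sph_point (fst p) (snd p) $ i)" for i
    using exhaust_3[of i]
    by (elim disjE) (simp_all only: sph_point_def vector_3, (intro continuous_intros)+)
  then have "continuous_on UNIV (\<lambda>p. \<chi> i. sph_point (fst p) (snd p) $ i)"
    by (rule continuous_on_vec_lambda)
  then show "(\<lambda>(\<theta>, \<phi>). sph_point \<theta> \<phi>) \<in> borel_measurable borel"
    unfolding vec_nth_inverse case_prod_unfold by (rule borel_measurable_continuous_onI)
qed (use sph_point_in_S2 in auto)

section \<open>Convergence in \<open>L\<^sup>2\<close>\<close>

definition L2_space :: "'b measure \<Rightarrow> ('b \<Rightarrow> real) set" where
  "L2_space N = {f \<in> borel_measurable N. integrable N (\<lambda>x. (f x)\<^sup>2)}"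

definition L2_norm :: "'b measure \<Rightarrow> ('b \<Rightarrow> real) \<Rightarrow> real" where
  "L2_norm N f = sqrt (\<integral>x. (f x)\<^sup>2 \<partial>N)"

definition L2_converges :: "'b measure \<Rightarrow> (nat \<Rightarrow> 'b \<Rightarrow> real) \<Rightarrow> ('b \<Rightarrow> real) \<Rightarrow> bool" where
  "L2_converges N f g \<longleftrightarrow>
     (\<forall>n. f n \<in> L2_space N) \<and> g \<in> L2_space N \<and>
     (\<lambda>n. L2_norm N (\<lambda>x. g x - f n x)) \<longlonglongrightarrow> 0"

section \<open>Legendre polynomials and associated Legendre functions\<close>

text \<open>Rodrigues' formula.\<close>

definition legendre :: "nat \<Rightarrow> real poly" where
  "legendre l = smult (1 / (2 ^ l * fact l)) ((pderiv ^^ l) ([:-1, 0, 1:] ^ l))"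

text \<open>\<open>(1 - \<mu>\<^sup>2)\<^bsup>m/2\<^esup>\<close> is written as a power of the square root: with \<open>powr\<close> it would be \<open>0\<close>
  instead of \<open>1\<close> at \<open>m = 0\<close>, \<open>\<mu> = \<plusminus>1\<close>.\<close>

definition assoc_legendre :: "nat \<Rightarrow> nat \<Rightarrow> real \<Rightarrow> real" where
  "assoc_legendre l m \<mu> =
     (-1) ^ m * sqrt (1 - \<mu>\<^sup>2) ^ m * poly ((pderiv ^^ m) (legendre l)) \<mu>"

definition L_fun :: "nat \<Rightarrow> nat \<Rightarrow> real \<Rightarrow> real" where
  "L_fun l m \<theta> =
     sqrt ((2 * real l + 1) / (4 * pi) * (fact (l - m) / fact (l + m))) * assoc_legendre l m (cos \<theta>)"

section \<open>Isotropic Gaussian random fields on the sphere\<close>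

text \<open>Degenerate (almost surely constant) variables count as Gaussian.\<close>

definition gaussian_rv :: "'a measure \<Rightarrow> ('a \<Rightarrow> real) \<Rightarrow> bool" where
  "gaussian_rv M X \<longleftrightarrow>
     X \<in> borel_measurable M \<and>
     ((\<exists>\<mu> \<sigma>. \<sigma> > 0 \<and> distributed M lborel X (\<lambda>x. ennreal (normal_density \<mu> \<sigma> x))) \<or>
      (\<exists>\<mu>. AE \<omega> in M. X \<omega> = \<mu>))"

text \<open>Gaussian means that all finite-dimensional distributions are (possibly degenerate)
  multivariate normal, i.e. that all finite linear combinations of values are Gaussian.\<close>

definition centered_isotropic_gaussian_field :: "'a measure \<Rightarrow> ('a \<Rightarrow> real^3 \<Rightarrow> real) \<Rightarrow> bool" where
  "centered_isotropic_gaussian_field M T \<longleftrightarrow>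
     (\<lambda>(\<omega>, y). T \<omega> y) \<in> borel_measurable (M \<Otimes>\<^sub>M restrict_space borel S2) \<and>
     (\<forall>n (a :: nat \<Rightarrow> real) x. (\<forall>i<n. x i \<in> S2) \<longrightarrow> gaussian_rv M (\<lambda>\<omega>. \<Sum>i<n. a i * T \<omega> (x i))) \<and>
     (\<forall>x\<in>S2. (\<integral>\<omega>. T \<omega> x \<partial>M) = 0) \<and>
     (\<forall>R x y. rotation_matrix R \<longrightarrow> x \<in> S2 \<longrightarrow> y \<in> S2 \<longrightarrow>
        (\<integral>\<omega>. T \<omega> (R *v x) * T \<omega> (R *v y) \<partial>M) = (\<integral>\<omega>. T \<omega> x * T \<omega> y \<partial>M))"

definition angular_power_spectrum ::
    "'a measure \<Rightarrow> ('a \<Rightarrow> real^3 \<Rightarrow> real) \<Rightarrow> (nat \<Rightarrow> real) \<Rightarrow> bool" where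
  "angular_power_spectrum M T A \<longleftrightarrow>
     (\<forall>l. A l \<ge> 0) \<and>
     (\<forall>x\<in>S2. \<forall>y\<in>S2.
        (\<lambda>l. A l * ((2 * real l + 1) / (4 * pi)) * poly (legendre l) (x \<bullet> y))
          sums (\<integral>\<omega>. T \<omega> x * T \<omega> y \<partial>M))"

section \<open>The Karhunen--Loeve series\<close>

definition truncated_field ::
    "(nat \<Rightarrow> real) \<Rightarrow> (nat \<Rightarrow> nat \<Rightarrow> 'a \<Rightarrow> real) \<Rightarrow> (nat \<Rightarrow> nat \<Rightarrow> 'a \<Rightarrow> real) \<Rightarrow>
      nat \<Rightarrow> 'a \<Rightarrow> real^3 \<Rightarrow> real" where
  "truncated_field A X1 X2 \<kappa> \<omega> y =
     (let \<theta> = colatitude y; \<phi> = longitude y in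
      \<Sum>l\<le>\<kappa>. sqrt (A l) * X1 l 0 \<omega> * L_fun l 0 \<theta> +
        sqrt (2 * A l) *
          (\<Sum>m=1..l. L_fun l m \<theta> * (X1 l m \<omega> * cos (real m * \<phi>) + X2 l m \<omega> * sin (real m * \<phi>))))"

definition independent_std_normals ::
    "'a measure \<Rightarrow> (nat \<Rightarrow> nat \<Rightarrow> 'a \<Rightarrow> real) \<Rightarrow> (nat \<Rightarrow> nat \<Rightarrow> 'a \<Rightarrow> real) \<Rightarrow> bool" where
  "independent_std_normals M X1 X2 \<longleftrightarrow>
     (\<forall>l m. m \<le> l \<longrightarrow> distributed M lborel (X1 l m) (\<lambda>x. ennreal (std_normal_density x))) \<and>
     (\<forall>l m. 1 \<le> m \<and> m \<le> l \<longrightarrow> distributed M lborel (X2 l m) (\<lambda>x. ennreal (std_normal_density x))) \<and>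
     prob_space.indep_vars M (\<lambda>_. borel) (case_sum (\<lambda>(l, m). X1 l m) (\<lambda>(l, m). X2 l m))
       ({(l, m). m \<le> l} <+> {(l, m). 1 \<le> m \<and> m \<le> l})"

text \<open>The series represents \<open>T\<close> in the sense of convergence in \<open>L\<^sup>2(\<Omega> \<times> S\<^sup>2)\<close>. This is implied
  by convergence in \<open>L\<^sup>2(\<Omega>)\<close>, or almost surely, at each single point of the sphere.\<close>

definition karhunen_loeve_expansion ::
    "'a measure \<Rightarrow> ('a \<Rightarrow> real^3 \<Rightarrow> real) \<Rightarrow> (nat \<Rightarrow> real) \<Rightarrow>
      (nat \<Rightarrow> nat \<Rightarrow> 'a \<Rightarrow> real) \<Rightarrow> (nat \<Rightarrow> nat \<Rightarrow> 'a \<Rightarrow> real) \<Rightarrow> bool" where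
  "karhunen_loeve_expansion M T A X1 X2 \<longleftrightarrow>
     independent_std_normals M X1 X2 \<and>
     L2_converges (M \<Otimes>\<^sub>M S2_measure)
       (\<lambda>\<kappa> (\<omega>, y). truncated_field A X1 X2 \<kappa> \<omega> y) (\<lambda>(\<omega>, y). T \<omega> y)"

end

theory Submission
  imports Defs
begin

text \<open>Write \<open>Y\<^sub>l\<close> for the sum of the squares of the \<open>2l + 1\<close> normal variables of degree \<open>l\<close> in the
  Karhunen--Loeve series. The functions multiplying \<open>sqrt A\<^sub>l\<close> times these variables are the real
  spherical harmonics, and they are orthonormal in \<open>L\<^sup>2\<close> of the sphere. Hence the squared distance of
  two truncations is, for every outcome, the partial sum of \<open>\<Sum> A\<^sub>l Y\<^sub>l\<close> over the degrees between them
  (\<open>truncated_field_diff_parseval\<close>), and the squared truncation error at \<open>\<kappa>\<close> should be the tail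
  \<open>\<Sum>\<^bsub>l > \<kappa>\<^esub> A\<^sub>l Y\<^sub>l\<close>.

  The decay of this tail follows from the means of the \<open>Y\<^sub>l\<close> alone. As \<open>\<Sum> l\<^bsup>2\<beta>\<^esup> A\<^sub>l E(Y\<^sub>l)\<close>
  is dominated by a multiple of \<open>\<Sum> l\<^bsup>2\<beta> + 1 - \<alpha>\<^esup>\<close>, up to finitely many terms, it is finite for \<open>\<beta> < (\<alpha> - 2) / 2\<close>, so the random series
  \<open>\<Sum> l\<^bsup>2\<beta>\<^esup> A\<^sub>l Y\<^sub>l\<close> converges almost surely (\<open>AE_summable_weighted_energy\<close>). For \<open>\<beta> \<ge> 0\<close> its tails, which tend to
  \<open>0\<close>, dominate \<open>\<kappa>\<^bsup>2\<beta>\<^esup> \<Sum>\<^bsub>l > \<kappa>\<^esub> A\<^sub>l Y\<^sub>l\<close> (\<open>weighted_summable_tail\<close>). This gives a bound with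
  constant \<open>1\<close> without any estimate of higher moments and without a Borel--Cantelli argument.

  It remains to connect the tail with \<open>T\<close>, which is the limit of the series only in \<open>L\<^sup>2\<close> of the product of the
  probability space and the sphere. That convergence yields a subsequence of truncations that
  converges to \<open>T\<close> in \<open>L\<^sup>2\<close> of the sphere almost surely (\<open>L2_converges_pair_AE_subseq\<close>), and passing through the
  subsequence bounds the squared error by twice the tail (\<open>truncation_error_le_tail\<close>).

  The orthonormality of the harmonics splits into that of \<open>1\<close>, \<open>cos (m\<phi>)\<close>, \<open>sin (m\<phi>)\<close> over a full period and
  that of the associated Legendre functions of equal order, which Rodrigues' formula reduces to
  repeated integration by parts of polynomials.\<close>

section \<open>Orthogonality of the associated Legendre functions\<close>

text \<open>The base of Rodrigues' formula, as a constant of its own so that simplification does not expand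
  its powers into coefficient lists.\<close>

definition quadric :: "real poly" where
  "quadric = [:-1, 0, 1:]"

lemma poly_quadric [simp]: "poly quadric x = x\<^sup>2 - 1"
  by (simp add: quadric_def power2_eq_square)

lemma degree_quadric_power: "degree (quadric ^ n) = 2 * n"
  by (simp add: quadric_def degree_power_eq)

lemma coeff_quadric_power: "coeff (quadric ^ n) (2 * n) = 1"
  using lead_coeff_power[of quadric n] unfolding degree_quadric_power
  by (simp add: quadric_def)

lemma legendre_eq: "legendre l = smult (1 / (2 ^ l * fact l)) ((pderiv ^^ l) (quadric ^ l))"
  by (simp add: legendre_def quadric_def)

text \<open>This is \<open>\<integral> p(x) dx\<close> over \<open>[-1, 1]\<close> in the variable \<open>x = cos \<theta>\<close>, the form in which it occurs on the
  sphere. The fundamental theorem of calculus applies to it directly, since \<open>- p(cos \<theta>)\<close> has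
  derivative \<open>p'(cos \<theta>) sin \<theta>\<close>; no change of variables is made.\<close>

definition cos_integral :: "real poly \<Rightarrow> real" where
  "cos_integral p = (LBINT \<theta>:{0..pi}. poly p (cos \<theta>) * sin \<theta>)"

lemma cos_integrable: "set_integrable lborel {0..pi} (\<lambda>\<theta>. poly p (cos \<theta>) * sin \<theta>)"
  by (intro borel_integrable_atLeastAtMost' continuous_intros)

lemma cos_integral_add: "cos_integral (p + q) = cos_integral p + cos_integral q"
  unfolding cos_integral_def
  by (subst set_integral_add(2)[OF cos_integrable cos_integrable, symmetric]) (simp add: algebra_simps)

lemma cos_integral_smult: "cos_integral (smult c p) = c * cos_integral p"
  unfolding cos_integral_def by (simp add: mult.assoc)

lemma cos_integral_pderiv: "cos_integral (pderiv p) = poly p 1 - poly p (-1)"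
proof -
  have "((\<lambda>\<theta>. - poly p (cos \<theta>)) has_real_derivative poly (pderiv p) (cos \<theta>) * sin \<theta>) (at \<theta>)" for \<theta>
    by (auto intro!: derivative_eq_intros DERIV_chain2[where g = cos and f = "poly p", OF poly_DERIV])
  moreover have "isCont (\<lambda>\<theta>. poly (pderiv p) (cos \<theta>) * sin \<theta>) \<theta>" for \<theta>
    by (intro continuous_intros)
  ultimately have "(\<integral>\<theta>. (poly (pderiv p) (cos \<theta>) * sin \<theta>) * indicator {0..pi} \<theta> \<partial>lborel)
      = - poly p (cos pi) - (- poly p (cos 0))"
    by (intro integral_FTC_Icc_real) simp_all
  then show ?thesis
    unfolding cos_integral_def set_lebesgue_integral_def by (simp add: mult.commute)
qed

lemma cos_integral_by_parts:
  assumes "quadric dvd u"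
  shows "cos_integral (pderiv u * q) = - cos_integral (u * pderiv q)"
proof -
  have "poly u 1 = 0" "poly u (-1) = 0"
    using assms by (auto elim!: dvdE)
  then have "cos_integral (pderiv (u * q)) = 0"
    by (simp add: cos_integral_pderiv)
  then show ?thesis
    by (simp add: pderiv_mult cos_integral_add mult.commute)
qed

lemma power_dvd_pderiv:
  fixes w :: "real poly"
  assumes "w ^ Suc n dvd u"
  shows "w ^ n dvd pderiv u"
proof -
  obtain v where "u = w ^ Suc n * v"
    using assms by (auto elim!: dvdE)
  then have "pderiv u = w ^ n * (w * pderiv v + smult (real (Suc n)) (pderiv w * v))"
    by (simp add: pderiv_mult pderiv_power_Suc smult_add_right algebra_simps del: of_nat_Suc power_Suc)
      (simp add: algebra_simps)
  then show ?thesis by simp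
qed

text \<open>Each integration by parts costs one factor of \<open>x\<^sup>2 - 1\<close>, which makes the boundary terms vanish.
  This lemma is used twice: with \<open>u = (x\<^sup>2 - 1)\<^sup>l\<close> it turns Rodrigues' formula into the
  orthogonality of \<open>P\<^sub>l\<close> to lower degrees, and with \<open>u = (x\<^sup>2 - 1)\<^sup>m P\<^sub>k\<^bsup>(m)\<^esup>\<close> it reduces the
  associated Legendre functions to Legendre polynomials.\<close>

lemma cos_integral_higher_by_parts:
  assumes "quadric ^ n dvd u"
  shows "cos_integral ((pderiv ^^ n) u * q) = (-1) ^ n * cos_integral (u * (pderiv ^^ n) q)"
  using assms
proof (induction n arbitrary: u q)
  case (Suc n)
  have "quadric dvd u"
    using Suc.prems by (rule dvd_trans[rotated]) simp
  have "cos_integral ((pderiv ^^ Suc n) u * q) = cos_integral ((pderiv ^^ n) (pderiv u) * q)"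
    by (simp only: funpow_Suc_right o_apply)
  also have "\<dots> = (-1) ^ n * cos_integral (pderiv u * (pderiv ^^ n) q)"
    using power_dvd_pderiv[OF Suc.prems] by (rule Suc.IH)
  also have "\<dots> = (-1) ^ Suc n * cos_integral (u * (pderiv ^^ Suc n) q)"
    using cos_integral_by_parts[OF \<open>quadric dvd u\<close>] by simp
  finally show ?case .
qed simp

text \<open>Integrating by parts against \<open>x\<close> and using \<open>x\<^sup>2 = (x\<^sup>2 - 1) + 1\<close>, the integrals \<open>J\<^sub>l\<close> of
  \<open>(x\<^sup>2 - 1)\<^sup>l\<close> satisfy \<open>(2l + 3) J\<^bsub>l+1\<^esub> = - 2(l + 1) J\<^sub>l\<close>.\<close>

lemma cos_integral_quadric_power:
  "cos_integral (quadric ^ l) = (-1) ^ l * 2 * (2 ^ l * fact l)\<^sup>2 / fact (2 * l + 1)"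
proof (induction l)
  case 0
  show ?case using cos_integral_pderiv[of "[:0, 1:]"] by (simp add: pderiv_pCons one_pCons)
next
  case (Suc l)
  let ?J = "\<lambda>l. cos_integral (quadric ^ l)"
  have "?J (Suc l) = cos_integral (quadric ^ Suc l * pderiv [:0, 1:])"
    by (simp add: pderiv_pCons)
  also have "\<dots> = - cos_integral (pderiv (quadric ^ Suc l) * [:0, 1:])"
    using cos_integral_by_parts[of "quadric ^ Suc l" "[:0, 1:]"] by simp
  also have "pderiv (quadric ^ Suc l) * [:0, 1:]
      = smult (2 * real (Suc l)) (quadric ^ Suc l + quadric ^ l)"
  proof -
    have "pderiv quadric * [:0, 1:] = smult 2 (quadric + 1)"
      by (simp add: quadric_def pderiv_pCons one_pCons)
    then have "pderiv (quadric ^ Suc l) * [:0, 1:] = smult (real (Suc l)) (quadric ^ l * smult 2 (quadric + 1))"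
      by (simp only: pderiv_power_Suc mult_smult_left mult.assoc)
    also have "\<dots> = smult (2 * real (Suc l)) (quadric ^ Suc l + quadric ^ l)"
      by (simp add: algebra_simps)
    finally show ?thesis .
  qed
  finally have "(2 * real l + 3) * ?J (Suc l) = - (2 * (real l + 1)) * ?J l"
    by (simp add: cos_integral_smult cos_integral_add algebra_simps)
  then have "?J (Suc l) = - (2 * (real l + 1)) / (2 * real l + 3) * ?J l"
    by (simp add: field_simps add_eq_0_iff)
  also have "\<dots> = (-1) ^ Suc l * 2 * (2 ^ Suc l * fact (Suc l))\<^sup>2 / fact (2 * Suc l + 1)"
  proof -
    have "(fact (2 * Suc l + 1) :: real) = (2 * real l + 3) * (2 * (real l + 1)) * fact (2 * l + 1)"
      by (simp add: fact_Suc algebra_simps)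
    moreover have "- (2 * x) / y * (s * 2 * (a * f)\<^sup>2 / F) = - s * 2 * (2 * a * (x * f))\<^sup>2 / (y * (2 * x) * F)"
      if "x \<noteq> 0" "y \<noteq> 0" "F \<noteq> 0" for x y s a f F :: real
      using that by (simp add: field_simps power2_eq_square)
    from this[of "real l + 1" "2 * real l + 3" "fact (2 * l + 1)" "(-1) ^ l" "2 ^ l" "fact l"]
    have "- (2 * (real l + 1)) / (2 * real l + 3) * ((-1) ^ l * 2 * (2 ^ l * fact l)\<^sup>2 / fact (2 * l + 1))
      = - ((-1) ^ l) * 2 * (2 * 2 ^ l * ((real l + 1) * fact l))\<^sup>2
          / ((2 * real l + 3) * (2 * (real l + 1)) * fact (2 * l + 1))"
      by (simp del: fact_Suc add: add_eq_0_iff)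
    ultimately show ?thesis
      unfolding Suc by (simp add: add.commute)
  qed
  finally show ?case .
qed

lemma degree_legendre_le: "degree (legendre l) \<le> l"
  by (simp add: legendre_eq degree_higher_pderiv degree_quadric_power)

lemma coeff_legendre: "coeff (legendre l) l = fact (2 * l) / (2 ^ l * (fact l)\<^sup>2)"
proof -
  have "coeff (quadric ^ l) (l + l) = 1"
    using coeff_quadric_power[of l] by (simp add: mult_2)
  moreover have "pochhammer (real (Suc l)) l = fact (2 * l) / fact l"
    using pochhammer_product[of l "2 * l" "1::real"]
    by (simp add: pochhammer_fact[symmetric] add.commute field_simps)
  ultimately show ?thesis
    by (simp add: legendre_eq coeff_higher_pderiv power2_eq_square del: of_nat_Suc)
qed

text \<open>After \<open>l\<close> integrations by parts only the \<open>l\<close>-th derivative of \<open>q\<close> is left, which is a constant.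
  In particular the integral vanishes if \<open>q\<close> has degree less than \<open>l\<close>.\<close>

lemma cos_integral_legendre_mult:
  assumes "degree q \<le> l"
  shows "cos_integral (legendre l * q) = 2 * 2 ^ l * (fact l)\<^sup>2 / fact (2 * l + 1) * coeff q l"
proof -
  have "(pderiv ^^ l) q = [:fact l * coeff q l:]"
  proof (rule poly_eqI)
    fix i
    have "pochhammer (1::real) l = fact l" by (rule pochhammer_fact[symmetric])
    then show "coeff ((pderiv ^^ l) q) i = coeff [:fact l * coeff q l:] i"
      using assms by (cases i) (auto simp: coeff_higher_pderiv coeff_eq_0)
  qed
  then have "cos_integral (legendre l * q)
      = 1 / (2 ^ l * fact l) * ((-1) ^ l * (fact l * coeff q l * cos_integral (quadric ^ l)))"
    by (simp add: legendre_eq cos_integral_smult cos_integral_higher_by_parts)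
  then show ?thesis
    unfolding cos_integral_quadric_power
    by (simp add: power2_eq_square power_mult_distrib[symmetric] del: fact_Suc)
qed

text \<open>Move the \<open>m\<close> derivatives off \<open>P\<^sub>l\<close>. The other factor becomes the \<open>m\<close>-th derivative of
  \<open>(x\<^sup>2 - 1)\<^sup>m P\<^sub>k\<^bsup>(m)\<^esup>\<close>, which has degree at most \<open>k\<close>: if \<open>k < l\<close> it is orthogonal to \<open>P\<^sub>l\<close>, and if
  \<open>k = l\<close> only its leading coefficient matters.\<close>

lemma cos_integral_assoc_legendre:
  assumes "m \<le> k" "k \<le> l"
  shows "(-1) ^ m * cos_integral (quadric ^ m * ((pderiv ^^ m) (legendre k) * (pderiv ^^ m) (legendre l)))
    = (if k = l then 2 / (2 * real l + 1) * (fact (l + m) / fact (l - m)) else 0)"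
proof -
  let ?u = "quadric ^ m * (pderiv ^^ m) (legendre k)"
  have deg_u: "degree ?u \<le> k + m"
    by (rule order.trans[OF degree_mult_le])
      (use degree_legendre_le[of k] assms in \<open>simp add: degree_quadric_power degree_higher_pderiv\<close>)
  then have deg: "degree ((pderiv ^^ m) ?u) \<le> k"
    by (simp add: degree_higher_pderiv)
  have "cos_integral (?u * (pderiv ^^ m) (legendre l))
      = (-1) ^ m * cos_integral (legendre l * (pderiv ^^ m) ?u)"
    using cos_integral_higher_by_parts[of m ?u "legendre l"] by (simp add: mult.commute[of "legendre l"])
  also have "cos_integral (legendre l * (pderiv ^^ m) ?u)
      = 2 * 2 ^ l * (fact l)\<^sup>2 / fact (2 * l + 1) * coeff ((pderiv ^^ m) ?u) l"
    using deg assms by (intro cos_integral_legendre_mult) simp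
  finally have *: "(-1) ^ m * cos_integral (?u * (pderiv ^^ m) (legendre l))
      = 2 * 2 ^ l * (fact l)\<^sup>2 / fact (2 * l + 1) * coeff ((pderiv ^^ m) ?u) l"
    by simp
  show ?thesis
  proof (cases "k = l")
    case False
    then have "coeff ((pderiv ^^ m) ?u) l = 0"
      using deg assms by (intro coeff_eq_0) simp
    with * False show ?thesis by (simp add: mult.assoc)
  next
    case True
    have poch: "pochhammer (real (Suc i)) m = fact (i + m) / fact i" for i
      using pochhammer_product[of i "i + m" "1::real"]
      by (simp add: pochhammer_fact[symmetric] add.commute field_simps)
    have "degree (legendre l) = l"
      using degree_legendre_le[of l] by (intro antisym le_degree) (simp_all add: coeff_legendre)
    then have "coeff ?u (2 * m + (l - m)) = coeff ((pderiv ^^ m) (legendre l)) (l - m)"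
      using coeff_mult_degree_sum[of "quadric ^ m" "(pderiv ^^ m) (legendre l)"]
        coeff_quadric_power[of m]
      by (simp add: True degree_quadric_power degree_higher_pderiv)
    moreover have "2 * m + (l - m) = l + m"
      using assms True by simp
    ultimately have "coeff ((pderiv ^^ m) ?u) l
        = fact (l + m) / fact l * (fact l / fact (l - m) * coeff (legendre l) l)"
      using assms True
      by (simp add: coeff_higher_pderiv poch del: of_nat_Suc)
    moreover have "(fact (2 * l + 1) :: real) = (2 * real l + 1) * fact (2 * l)"
      by simp
    ultimately show ?thesis
      using * True
      by (simp add: coeff_legendre mult.assoc power2_eq_square del: fact_Suc)
  qed
qed

text \<open>The value is \<open>1 / (2\<pi>)\<close> and not \<open>1\<close>, since the azimuthal factors below have square integral
  \<open>2\<pi>\<close>.\<close>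

lemma L_fun_orthonormal:
  assumes "m \<le> l" "m \<le> k"
  shows "(LBINT \<theta>:{0..pi}. L_fun l m \<theta> * L_fun k m \<theta> * sin \<theta>) = (if l = k then 1 / (2 * pi) else 0)"
proof -
  define c where "c l = sqrt ((2 * real l + 1) / (4 * pi) * (fact (l - m) / fact (l + m)))" for l
  define p where "p = quadric ^ m * ((pderiv ^^ m) (legendre l) * (pderiv ^^ m) (legendre k))"
  have sq: "sqrt (1 - (cos \<theta>)\<^sup>2) ^ m * sqrt (1 - (cos \<theta>)\<^sup>2) ^ m = (-1) ^ m * poly quadric (cos \<theta>) ^ m" for \<theta>
  proof -
    have "sqrt (1 - (cos \<theta>)\<^sup>2) * sqrt (1 - (cos \<theta>)\<^sup>2) = - poly quadric (cos \<theta>)"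
      by (subst real_sqrt_mult_self) (simp_all add: power2_eq_square abs_square_le_1[unfolded power2_eq_square])
    then show ?thesis by (metis power_mult_distrib mult_minus1)
  qed
  have eq: "L_fun l m \<theta> * L_fun k m \<theta> * sin \<theta> = poly (smult (c l * c k * (-1) ^ m) p) (cos \<theta>) * sin \<theta>" for \<theta>
  proof -
    have "L_fun l m \<theta> * L_fun k m \<theta> = c l * c k * ((-1) ^ m * (-1) ^ m)
        * (sqrt (1 - (cos \<theta>)\<^sup>2) ^ m * sqrt (1 - (cos \<theta>)\<^sup>2) ^ m)
        * (poly ((pderiv ^^ m) (legendre l)) (cos \<theta>) * poly ((pderiv ^^ m) (legendre k)) (cos \<theta>))"
      by (simp only: L_fun_def assoc_legendre_def c_def mult_ac)
    also have "\<dots> = poly (smult (c l * c k * (-1) ^ m) p) (cos \<theta>)"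
      unfolding sq by (simp add: p_def poly_power)
    finally show ?thesis by simp
  qed
  have I: "(LBINT \<theta>:{0..pi}. L_fun l m \<theta> * L_fun k m \<theta> * sin \<theta>) = c l * c k * ((-1) ^ m * cos_integral p)"
    unfolding eq by (simp only: cos_integral_def[symmetric] cos_integral_smult mult.assoc)
  have J: "(-1) ^ m * cos_integral p
      = (if l = k then 2 / (2 * real l + 1) * (fact (l + m) / fact (l - m)) else 0)"
  proof (cases "l \<le> k")
    case True
    with assms show ?thesis unfolding p_def by (simp add: cos_integral_assoc_legendre)
  next
    case False
    then show ?thesis
      unfolding p_def mult.commute[of "(pderiv ^^ m) (legendre l)"]
      using assms by (simp add: cos_integral_assoc_legendre)
  qed
  have "c l * c l = (2 * real l + 1) / (4 * pi) * (fact (l - m) / fact (l + m))"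
    unfolding c_def by (rule real_sqrt_mult_self[THEN trans]) simp
  then show "(LBINT \<theta>:{0..pi}. L_fun l m \<theta> * L_fun k m \<theta> * sin \<theta>) = (if l = k then 1 / (2 * pi) else 0)"
    unfolding I J by (cases "l = k") (simp_all add: add_eq_0_iff)
qed

section \<open>Real spherical harmonics and Parseval's identity\<close>

text \<open>A signed order \<open>k\<close> selects the cosine of \<open>k\<phi>\<close> for \<open>k > 0\<close> and the sine of \<open>\<bar>k\<bar>\<phi>\<close> for \<open>k < 0\<close>, so
  that the two families of terms in the Karhunen--Loeve series are indexed together. The factor
  \<open>sqrt 2\<close> is the one in \<open>sqrt (2 A\<^sub>l)\<close>; with it, all these functions have the same norm.\<close>

definition azimuthal :: "int \<Rightarrow> real \<Rightarrow> real" where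
  "azimuthal k \<phi> =
     (if k = 0 then 1 else if k > 0 then sqrt 2 * cos (of_int k * \<phi>) else sqrt 2 * sin (of_int (-k) * \<phi>))"

lemma continuous_on_azimuthal [continuous_intros]: "continuous_on S (azimuthal k)"
  by (cases k "0 :: int" rule: linorder_cases) (auto simp: azimuthal_def intro!: continuous_intros)

lemma has_integral_cos_int:
  "((\<lambda>\<phi>. cos (of_int n * \<phi>)) has_integral (if n = 0 then 2 * pi else 0)) {0..2 * pi}" for n :: int
proof (cases "n = 0")
  case True
  then show ?thesis
    using has_integral_const_real[of "1 :: real" 0 "2 * pi"] by simp
next
  case False
  have "((\<lambda>\<phi>. cos (of_int n * \<phi>)) has_integral
      sin (of_int n * (2 * pi)) / of_int n - sin (of_int n * 0) / of_int n) {0..2 * pi}"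
    by (rule fundamental_theorem_of_calculus)
      (use False in \<open>auto intro!: derivative_eq_intros simp flip: has_real_derivative_iff_has_vector_derivative\<close>)
  then show ?thesis
    using False sin_int_2pin[of n] by (simp add: mult_ac)
qed

lemma has_integral_sin_int:
  "((\<lambda>\<phi>. sin (of_int n * \<phi>)) has_integral 0) {0..2 * pi}" for n :: int
proof (cases "n = 0")
  case False
  have "((\<lambda>\<phi>. sin (of_int n * \<phi>)) has_integral
      - cos (of_int n * (2 * pi)) / of_int n - - cos (of_int n * 0) / of_int n) {0..2 * pi}"
    by (rule fundamental_theorem_of_calculus)
      (use False in \<open>auto intro!: derivative_eq_intros simp flip: has_real_derivative_iff_has_vector_derivative\<close>)
  then show ?thesis
    using False cos_int_2pin[of n] by (simp add: mult_ac)
qed simp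

text \<open>By the product formulas, a product of two such functions is a combination of \<open>cos (n \<phi>)\<close> and
  \<open>sin (n \<phi>)\<close> with integer \<open>n\<close>, and only \<open>cos 0\<close> has a nonzero integral over a full period.\<close>

lemma azimuthal_orthogonal:
  "(LBINT \<phi>:{0..<2*pi}. azimuthal j \<phi> * azimuthal k \<phi>) = (if j = k then 2 * pi else 0)"
proof -
  note C = has_integral_cos_int and S = has_integral_sin_int
  have D: "((\<lambda>\<phi>. a * f \<phi> + b * g \<phi>) has_integral a * x + b * y) {0..2 * pi}"
    if "(f has_integral x) {0..2 * pi}" "(g has_integral y) {0..2 * pi}"
    for a b x y :: real and f g :: "real \<Rightarrow> real"
    by (intro has_integral_add has_integral_mult_right that)
  have I: "((\<lambda>\<phi>. azimuthal j \<phi> * azimuthal k \<phi>) has_integral (if j = k then 2 * pi else 0)) {0..2 * pi}"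
  proof -
    consider "j = 0" | "k = 0" | "j > 0" "k > 0" | "j < 0" "k < 0" | "j > 0" "k < 0" | "j < 0" "k > 0"
      by linarith
    then show ?thesis
    proof cases
      case 1
      then show ?thesis
        using has_integral_mult_right[OF C[of k], of "sqrt 2"] has_integral_mult_right[OF S[of "-k"], of "sqrt 2"] C[of 0]
        unfolding azimuthal_def by (cases k "0::int" rule: linorder_cases) auto
    next
      case 2
      then show ?thesis
        using has_integral_mult_right[OF C[of j], of "sqrt 2"] has_integral_mult_right[OF S[of "-j"], of "sqrt 2"] C[of 0]
        unfolding azimuthal_def by (cases j "0::int" rule: linorder_cases) auto
    next
      case 3
      have "(\<lambda>\<phi>. azimuthal j \<phi> * azimuthal k \<phi>)
          = (\<lambda>\<phi>. 1 * cos (of_int (j - k) * \<phi>) + 1 * cos (of_int (j + k) * \<phi>))"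
        using 3 by (simp add: fun_eq_iff azimuthal_def algebra_simps cos_add cos_diff)
      then show ?thesis
        using D[OF C[of "j - k"] C[of "j + k"], of 1 1] 3 by (auto split: if_splits)
    next
      case 4
      have "(\<lambda>\<phi>. azimuthal j \<phi> * azimuthal k \<phi>)
          = (\<lambda>\<phi>. 1 * cos (of_int (j - k) * \<phi>) + (-1) * cos (of_int (j + k) * \<phi>))"
        using 4 by (simp add: fun_eq_iff azimuthal_def algebra_simps cos_add cos_diff)
      then show ?thesis
        using D[OF C[of "j - k"] C[of "j + k"], of 1 "-1"] 4 by (auto split: if_splits)
    next
      case 5
      have "(\<lambda>\<phi>. azimuthal j \<phi> * azimuthal k \<phi>)
          = (\<lambda>\<phi>. 1 * sin (of_int (j - k) * \<phi>) + (-1) * sin (of_int (j + k) * \<phi>))"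
        using 5 by (simp add: fun_eq_iff azimuthal_def algebra_simps sin_add sin_diff)
      then show ?thesis
        using D[OF S[of "j - k"] S[of "j + k"], of 1 "-1"] 5 by (auto split: if_splits)
    next
      case 6
      have "(\<lambda>\<phi>. azimuthal j \<phi> * azimuthal k \<phi>)
          = (\<lambda>\<phi>. (-1) * sin (of_int (j - k) * \<phi>) + (-1) * sin (of_int (j + k) * \<phi>))"
        using 6 by (simp add: fun_eq_iff azimuthal_def algebra_simps sin_add sin_diff)
      then show ?thesis
        using D[OF S[of "j - k"] S[of "j + k"], of "-1" "-1"] 6 by (auto split: if_splits)
    qed
  qed
  \<comment> \<open>The longitude ranges over a half-open interval, whose missing endpoint is a null set.\<close>
  have "(LBINT \<phi>:{0..<2*pi}. azimuthal j \<phi> * azimuthal k \<phi>) = (LBINT \<phi>:{0..2*pi}. azimuthal j \<phi> * azimuthal k \<phi>)"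
    unfolding set_lebesgue_integral_def
    by (rule integral_cong_AE; (measurable)?; (intro eventually_mono[OF AE_lborel_singleton[of "2 * pi"]])?)
      (auto simp: indicator_def intro!: borel_measurable_times borel_measurable_continuous_onI continuous_intros)
  also have "\<dots> = integral {0..2 * pi} (\<lambda>\<phi>. azimuthal j \<phi> * azimuthal k \<phi>)"
    by (intro set_borel_integral_eq_integral borel_integrable_atLeastAtMost' continuous_intros)
  also have "\<dots> = (if j = k then 2 * pi else 0)"
    using I by (rule integral_unique)
  finally show ?thesis .
qed

lemma continuous_on_L_fun [continuous_intros]: "continuous_on S (L_fun l m)"
  unfolding L_fun_def assoc_legendre_def by (intro continuous_intros)

lemma lborel_integral_mult:
  fixes f g :: "real \<Rightarrow> real"
  assumes f: "integrable lborel f" and g: "integrable lborel g"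
  shows "integrable lborel (\<lambda>(x, y). f x * g y)"
    and "(\<integral>p. (case p of (x, y) \<Rightarrow> f x * g y) \<partial>lborel) = (\<integral>x. f x \<partial>lborel) * (\<integral>y. g y \<partial>lborel)"
proof -
  note [measurable] = borel_measurable_integrable[OF f] borel_measurable_integrable[OF g]
  have int: "integrable (lborel \<Otimes>\<^sub>M lborel) (\<lambda>(x, y). f x * g y)"
    using f g by (intro lborel_pair.Fubini_integrable) (simp_all add: abs_mult)
  then show "integrable lborel (\<lambda>(x, y). f x * g y)"
    by (simp add: lborel_prod)
  show "(\<integral>p. (case p of (x, y) \<Rightarrow> f x * g y) \<partial>lborel) = (\<integral>x. f x \<partial>lborel) * (\<integral>y. g y \<partial>lborel)"
    using lborel_pair.integral_fst'[OF int] f g by (simp add: lborel_prod)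
qed

lemma colatitude_sph_point: "0 \<le> \<theta> \<Longrightarrow> \<theta> \<le> pi \<Longrightarrow> colatitude (sph_point \<theta> \<phi>) = \<theta>"
  by (simp add: colatitude_def sph_point_def arccos_cos)

lemma longitude_sph_point:
  assumes "0 < \<theta>" "\<theta> < pi" "0 \<le> \<phi>" "\<phi> < 2 * pi"
  shows "longitude (sph_point \<theta> \<phi>) = \<phi>"
proof -
  have "of_real (sin \<theta>) * exp (\<i> * of_real \<phi>) = Complex (sin \<theta> * cos \<phi>) (sin \<theta> * sin \<phi>)"
    by (simp add: complex_eq_iff Re_exp Im_exp)
  then show ?thesis
    unfolding longitude_def sph_point_def vector_3
    using assms by (intro Arg2pi_unique[of "sin \<theta>"]) (auto intro: sin_gt_zero)
qed

lemma sets_S2_measure: "sets S2_measure = sets (restrict_space borel S2)"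
  by (simp add: S2_measure_def)

text \<open>The coordinate expression \<open>g\<close> of \<open>f\<close> may fail at the poles \<open>\<theta> = 0\<close> and \<open>\<theta> = \<pi>\<close>, where the longitude
  is not recovered from the point: the density \<open>sin \<theta>\<close> vanishes there, so the integrands on both
  sides agree everywhere.\<close>

lemma S2_measure_in_coordinates:
  fixes f :: "real^3 \<Rightarrow> real" and g :: "real \<Rightarrow> real \<Rightarrow> real"
  assumes f: "f \<in> borel_measurable S2_measure"
    and g: "\<And>\<theta> \<phi>. 0 < \<theta> \<Longrightarrow> \<theta> < pi \<Longrightarrow> 0 \<le> \<phi> \<Longrightarrow> \<phi> < 2 * pi \<Longrightarrow> f (sph_point \<theta> \<phi>) = g \<theta> \<phi>"
  shows "(\<integral>y. f y \<partial>S2_measure)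
      = (\<integral>p. (case p of (\<theta>, \<phi>) \<Rightarrow> indicator {0..pi} \<theta> * indicator {0..<2*pi} \<phi> * (sin \<theta> * g \<theta> \<phi>)) \<partial>lborel)"
    and "integrable S2_measure f \<longleftrightarrow>
      integrable lborel (\<lambda>(\<theta>, \<phi>). indicator {0..pi} \<theta> * indicator {0..<2*pi} \<phi> * (sin \<theta> * g \<theta> \<phi>))"
proof -
  let ?D = "{0..pi} \<times> {0..<2*pi} :: (real \<times> real) set"
  let ?R = "restrict_space lborel ?D"
  let ?s = "\<lambda>p :: real \<times> real. sin (fst p)"
  let ?P = "\<lambda>p. sph_point (fst p) (snd p)"
  have D: "?D \<inter> space lborel \<in> sets lborel"
    by (simp add: borel_Times)
  have f': "f \<in> borel_measurable (restrict_space borel S2)"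
    using f measurable_cong_sets[OF sets_S2_measure refl] by blast
  have [measurable]: "?P \<in> borel \<rightarrow>\<^sub>M restrict_space borel S2"
    using measurable_sph_point by (simp add: case_prod_unfold)
  then have P: "?P \<in> ?R \<rightarrow>\<^sub>M restrict_space borel S2"
    by (intro measurable_restrict_space1) (simp add: measurable_lborel1)
  have s: "?s \<in> borel_measurable ?R"
    by (intro measurable_restrict_space1) (simp add: borel_measurable_continuous_onI continuous_intros)
  have nn: "AE p in ?R. 0 \<le> ?s p"
    by (rule AE_I2) (auto simp: space_restrict_space sin_ge_zero)
  have fP: "(\<lambda>p. f (?P p)) \<in> borel_measurable ?R"
    using measurable_compose[OF P f'] .
  have S2: "S2_measure = distr (density ?R (\<lambda>p. ennreal (?s p))) (restrict_space borel S2) ?P"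
    by (simp add: S2_measure_def case_prod_unfold)
  have dens: "?P \<in> density ?R (\<lambda>p. ennreal (?s p)) \<rightarrow>\<^sub>M restrict_space borel S2"
    using P by simp
  have eq: "indicator ?D p *\<^sub>R (?s p *\<^sub>R f (?P p))
      = (case p of (\<theta>, \<phi>) \<Rightarrow> indicator {0..pi} \<theta> * indicator {0..<2*pi} \<phi> * (sin \<theta> * g \<theta> \<phi>))" for p
    using g[of "fst p" "snd p"]
    by (cases p; cases "fst p = 0 \<or> fst p = pi") (auto simp: indicator_def)
  show "(\<integral>y. f y \<partial>S2_measure)
      = (\<integral>p. (case p of (\<theta>, \<phi>) \<Rightarrow> indicator {0..pi} \<theta> * indicator {0..<2*pi} \<phi> * (sin \<theta> * g \<theta> \<phi>)) \<partial>lborel)"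
    unfolding S2 integral_distr[OF dens f'] integral_density[OF fP s nn] integral_restrict_space[OF D] eq ..
  show "integrable S2_measure f \<longleftrightarrow>
      integrable lborel (\<lambda>(\<theta>, \<phi>). indicator {0..pi} \<theta> * indicator {0..<2*pi} \<phi> * (sin \<theta> * g \<theta> \<phi>))"
    unfolding S2 integrable_distr_eq[OF dens f'] integrable_density[OF fP s nn] integrable_restrict_space[OF D] eq ..
qed

lemma finite_measure_S2_measure: "finite_measure S2_measure"
proof -
  have i: "integrable lborel (\<lambda>\<theta>. indicator {0..pi} \<theta> * sin \<theta>)" "integrable lborel (indicator {0..<2*pi} :: real \<Rightarrow> real)"
    using borel_integrable_atLeastAtMost'[OF continuous_on_sin[OF continuous_on_id], of 0 pi]
    by (auto simp: set_integrable_def)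
  have "integrable S2_measure (\<lambda>_. 1 :: real)"
    using lborel_integral_mult(1)[OF i] by (subst S2_measure_in_coordinates(2)[where g = "\<lambda>_ _. 1"]) (simp_all add: mult_ac)
  then show ?thesis
    by (intro finite_measureI) (auto simp: integrable_iff_bounded)
qed

text \<open>These are the real spherical harmonics, in the normalisation that makes them orthonormal for the
  surface measure.\<close>

definition sph_harmonic :: "nat \<Rightarrow> int \<Rightarrow> real^3 \<Rightarrow> real" where
  "sph_harmonic l k y = L_fun l (nat \<bar>k\<bar>) (colatitude y) * azimuthal k (longitude y)"

text \<open>Pulled back to the coordinate rectangle, the square of a linear combination of harmonics is a
  finite double sum of functions of \<open>\<theta>\<close> times functions of \<open>\<phi>\<close>. If the orders \<open>j\<close> and \<open>k\<close> of a pair differ, the integral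
  over \<open>\<phi>\<close> vanishes; if they agree, so do the \<open>m = \<bar>k\<bar>\<close> of the two Legendre functions, and the
  integral over \<open>\<theta>\<close> separates the degrees.\<close>

lemma sph_harmonic_parseval:
  assumes I: "finite I" "\<And>l k. (l, k) \<in> I \<Longrightarrow> \<bar>k\<bar> \<le> int l"
    and F: "F \<in> borel_measurable S2_measure" "\<And>y. F y = (\<Sum>(l, k)\<in>I. c l k * sph_harmonic l k y)"
  shows "integrable S2_measure (\<lambda>y. (F y)\<^sup>2)"
    and "(\<integral>y. (F y)\<^sup>2 \<partial>S2_measure) = (\<Sum>(l, k)\<in>I. (c l k)\<^sup>2)"
proof -
  define u where "u i j \<theta> = indicator {0..pi} \<theta> *
      (L_fun (fst i) (nat \<bar>snd i\<bar>) \<theta> * L_fun (fst j) (nat \<bar>snd j\<bar>) \<theta> * sin \<theta>)" for i j :: "nat \<times> int" and \<theta> :: real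
  define v where "v i j \<phi> = indicator {0..<2*pi} \<phi> * (azimuthal (snd i) \<phi> * azimuthal (snd j) \<phi>)"
    for i j :: "nat \<times> int" and \<phi> :: real
  define g where "g \<theta> \<phi> = (\<Sum>(l, k)\<in>I. c l k * (L_fun l (nat \<bar>k\<bar>) \<theta> * azimuthal k \<phi>))\<^sup>2" for \<theta> \<phi>
  let ?c = "\<lambda>i. c (fst i) (snd i)"
  have u: "integrable lborel (u i j)" for i j
    using borel_integrable_atLeastAtMost'[of 0 pi "\<lambda>\<theta>. L_fun (fst i) (nat \<bar>snd i\<bar>) \<theta> * L_fun (fst j) (nat \<bar>snd j\<bar>) \<theta> * sin \<theta>"]
    unfolding u_def set_integrable_def by (simp add: continuous_intros)
  have v: "integrable lborel (v i j)" for i j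
  proof -
    have "set_integrable lborel {0..2*pi} (\<lambda>\<phi>. azimuthal (snd i) \<phi> * azimuthal (snd j) \<phi>)"
      by (intro borel_integrable_atLeastAtMost' continuous_intros)
    then have "set_integrable lborel {0..<2*pi} (\<lambda>\<phi>. azimuthal (snd i) \<phi> * azimuthal (snd j) \<phi>)"
      by (rule set_integrable_subset) auto
    then show ?thesis unfolding v_def set_integrable_def by simp
  qed
  note uv = lborel_integral_mult[OF u v]
  have expand: "(\<lambda>(\<theta>, \<phi>). indicator {0..pi} \<theta> * indicator {0..<2*pi} \<phi> * (sin \<theta> * g \<theta> \<phi>))
      = (\<lambda>p. \<Sum>i\<in>I. \<Sum>j\<in>I. ?c i * ?c j * (case p of (\<theta>, \<phi>) \<Rightarrow> u i j \<theta> * v i j \<phi>))"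
    by (auto simp: fun_eq_iff g_def u_def v_def power2_eq_square sum_product case_prod_unfold
        sum_distrib_left mult_ac intro!: sum.cong)
  have meas: "(\<lambda>y. (F y)\<^sup>2) \<in> borel_measurable S2_measure"
    using F(1) by simp
  have coord: "(F (sph_point \<theta> \<phi>))\<^sup>2 = g \<theta> \<phi>" if "0 < \<theta>" "\<theta> < pi" "0 \<le> \<phi>" "\<phi> < 2 * pi" for \<theta> \<phi>
    using that by (simp add: F(2) g_def sph_harmonic_def colatitude_sph_point longitude_sph_point)
  show "integrable S2_measure (\<lambda>y. (F y)\<^sup>2)"
    unfolding S2_measure_in_coordinates(2)[OF meas coord, simplified] expand
    by (intro Bochner_Integration.integrable_sum integrable_mult_right uv)
  have orth: "(\<integral>\<theta>. u i j \<theta> \<partial>lborel) * (\<integral>\<phi>. v i j \<phi> \<partial>lborel) = (if i = j then 1 else 0)" if "i \<in> I" "j \<in> I" for i j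
  proof (cases "snd i = snd j")
    case True
    have "(\<integral>\<theta>. u i j \<theta> \<partial>lborel) = (if fst i = fst j then 1 / (2 * pi) else 0)"
    proof -
      have "(fst i, snd i) \<in> I" "(fst j, snd j) \<in> I"
        using that by simp_all
      from this[THEN I(2)] have "nat \<bar>snd i\<bar> \<le> fst i" "nat \<bar>snd i\<bar> \<le> fst j"
        using True by auto
      from L_fun_orthonormal[OF this] True show ?thesis
        by (simp add: u_def set_lebesgue_integral_def)
    qed
    moreover have "(\<integral>\<phi>. v i j \<phi> \<partial>lborel) = 2 * pi"
      using azimuthal_orthogonal[of "snd i" "snd j"] True by (simp add: v_def set_lebesgue_integral_def)
    ultimately show ?thesis
      using True by (simp add: prod_eq_iff)
  next
    case False
    then have "(\<integral>\<phi>. v i j \<phi> \<partial>lborel) = 0"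
      using azimuthal_orthogonal[of "snd i" "snd j"] by (simp add: v_def set_lebesgue_integral_def)
    with False show ?thesis by auto
  qed
  have "(\<integral>y. (F y)\<^sup>2 \<partial>S2_measure)
      = (\<Sum>i\<in>I. \<Sum>j\<in>I. ?c i * ?c j * ((\<integral>\<theta>. u i j \<theta> \<partial>lborel) * (\<integral>\<phi>. v i j \<phi> \<partial>lborel)))"
    unfolding S2_measure_in_coordinates(1)[OF meas coord, simplified] expand
    by (simp add: Bochner_Integration.integral_sum Bochner_Integration.integrable_sum uv)
  also have "\<dots> = (\<Sum>i\<in>I. \<Sum>j\<in>I. if i = j then (?c i)\<^sup>2 else 0)"
    by (intro sum.cong refl) (simp add: orth power2_eq_square)
  also have "\<dots> = (\<Sum>(l, k)\<in>I. (c l k)\<^sup>2)"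
    using I(1) by (simp add: case_prod_unfold)
  finally show "(\<integral>y. (F y)\<^sup>2 \<partial>S2_measure) = (\<Sum>(l, k)\<in>I. (c l k)\<^sup>2)" .
qed

section \<open>The truncation error as the tail of a random series\<close>

text \<open>Negative orders refer to the sine terms, in accordance with \<open>azimuthal\<close>.\<close>

definition kl_coeff :: "(nat \<Rightarrow> nat \<Rightarrow> 'a \<Rightarrow> real) \<Rightarrow> (nat \<Rightarrow> nat \<Rightarrow> 'a \<Rightarrow> real) \<Rightarrow> nat \<Rightarrow> int \<Rightarrow> 'a \<Rightarrow> real" where
  "kl_coeff X1 X2 l k = (if k \<ge> 0 then X1 l (nat k) else X2 l (nat (-k)))"

definition degree_energy :: "(nat \<Rightarrow> nat \<Rightarrow> 'a \<Rightarrow> real) \<Rightarrow> (nat \<Rightarrow> nat \<Rightarrow> 'a \<Rightarrow> real) \<Rightarrow> nat \<Rightarrow> 'a \<Rightarrow> real" where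
  "degree_energy X1 X2 l \<omega> = (\<Sum>k\<in>{-int l..int l}. (kl_coeff X1 X2 l k \<omega>)\<^sup>2)"

lemma sum_int_symmetric:
  fixes f :: "int \<Rightarrow> real"
  shows "(\<Sum>k\<in>{-int l..int l}. f k) = f 0 + (\<Sum>m=1..l. f (int m) + f (- int m))"
proof (induction l)
  case (Suc l)
  have "{-int (Suc l)..int (Suc l)} = insert (int (Suc l)) (insert (- int (Suc l)) {-int l..int l})"
    by auto
  then have "(\<Sum>k\<in>{-int (Suc l)..int (Suc l)}. f k)
      = f (int (Suc l)) + (f (- int (Suc l)) + (\<Sum>k\<in>{-int l..int l}. f k))"
    by (simp del: of_nat_Suc)
  then show ?case
    unfolding Suc by simp
qed simp

text \<open>The series in the form to which Parseval's identity applies.\<close>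

lemma truncated_field_eq:
  assumes "\<And>l. A l \<ge> 0"
  shows "truncated_field A X1 X2 \<kappa> \<omega> y
    = (\<Sum>l\<le>\<kappa>. \<Sum>k\<in>{-int l..int l}. sqrt (A l) * kl_coeff X1 X2 l k \<omega> * sph_harmonic l k y)"
  unfolding truncated_field_def Let_def sum_int_symmetric
  by (intro sum.cong refl arg_cong2[where f = "(+)"])
    (auto simp: kl_coeff_def sph_harmonic_def azimuthal_def sum_distrib_left real_sqrt_mult algebra_simps
      intro!: sum.cong)

text \<open>The harmonics of the degrees up to \<open>\<kappa>\<close> cancel, and the other ones are orthonormal. The identity
  holds for each outcome \<open>\<omega>\<close>, whatever the values of the random variables are.\<close>

lemma truncated_field_diff_parseval:
  assumes A: "\<And>l. A l \<ge> 0" and le: "\<kappa> \<le> n"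
    and meas: "truncated_field A X1 X2 n \<omega> \<in> borel_measurable S2_measure"
      "truncated_field A X1 X2 \<kappa> \<omega> \<in> borel_measurable S2_measure"
  shows "(\<integral>y. (truncated_field A X1 X2 n \<omega> y - truncated_field A X1 X2 \<kappa> \<omega> y)\<^sup>2 \<partial>S2_measure)
    = (\<Sum>l\<in>{\<kappa><..n}. A l * degree_energy X1 X2 l \<omega>)"
proof -
  let ?I = "SIGMA l:{\<kappa><..n}. {-int l..int l}"
  let ?c = "\<lambda>l k. sqrt (A l) * kl_coeff X1 X2 l k \<omega>"
  have diff: "truncated_field A X1 X2 n \<omega> y - truncated_field A X1 X2 \<kappa> \<omega> y
      = (\<Sum>(l, k)\<in>?I. ?c l k * sph_harmonic l k y)" for y
  proof -
    have *: "{..n} = {..\<kappa>} \<union> {\<kappa><..n}" "{..\<kappa>} \<inter> {\<kappa><..n} = {}"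
      using le by auto
    show ?thesis
      unfolding truncated_field_eq[OF A] *(1) by (subst sum.union_disjoint) (auto simp: sum.Sigma)
  qed
  have "(\<integral>y. (truncated_field A X1 X2 n \<omega> y - truncated_field A X1 X2 \<kappa> \<omega> y)\<^sup>2 \<partial>S2_measure)
      = (\<Sum>(l, k)\<in>?I. (?c l k)\<^sup>2)"
    by (intro sph_harmonic_parseval(2) diff borel_measurable_diff meas) auto
  also have "\<dots> = (\<Sum>l\<in>{\<kappa><..n}. A l * degree_energy X1 X2 l \<omega>)"
    by (simp add: sum.Sigma[symmetric] degree_energy_def sum_distrib_left power_mult_distrib A)
  finally show ?thesis .
qed

section \<open>Square-integrable functions on a product space\<close>

lemma integrable_L2_space_diff_square:
  assumes "f \<in> L2_space N" "g \<in> L2_space N"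
  shows "integrable N (\<lambda>x. (f x - g x)\<^sup>2)"
proof (rule Bochner_Integration.integrable_bound)
  show "integrable N (\<lambda>x. 2 * (f x)\<^sup>2 + 2 * (g x)\<^sup>2)"
    using assms by (auto simp: L2_space_def)
  show "(\<lambda>x. (f x - g x)\<^sup>2) \<in> borel_measurable N"
    using assms by (auto simp: L2_space_def)
  have "(a - b)\<^sup>2 \<le> 2 * a\<^sup>2 + 2 * b\<^sup>2" for a b :: real
    using sum_squares_bound[of a "-b"] by (simp add: power2_diff)
  then show "AE x in N. norm ((f x - g x)\<^sup>2) \<le> norm (2 * (f x)\<^sup>2 + 2 * (g x)\<^sup>2)"
    by simp
qed

text \<open>A substitute for Minkowski's inequality that stays with squares; the factor \<open>2\<close> is harmless for
  rates of convergence.\<close>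

lemma L2_diff_square_triangle:
  assumes "f \<in> L2_space N" "g \<in> L2_space N" "h \<in> L2_space N"
  shows "(\<integral>x. (f x - h x)\<^sup>2 \<partial>N) \<le> 2 * (\<integral>x. (f x - g x)\<^sup>2 \<partial>N) + 2 * (\<integral>x. (g x - h x)\<^sup>2 \<partial>N)"
proof -
  note int = integrable_L2_space_diff_square[OF assms(1) assms(2)]
    integrable_L2_space_diff_square[OF assms(2) assms(3)] integrable_L2_space_diff_square[OF assms(1) assms(3)]
  have "(a - c)\<^sup>2 \<le> 2 * (a - b)\<^sup>2 + 2 * (b - c)\<^sup>2" for a b c :: real
    using sum_squares_bound[of "a - b" "b - c"] power2_sum[of "a - b" "b - c"] by simp
  then have "(\<integral>x. (f x - h x)\<^sup>2 \<partial>N) \<le> (\<integral>x. 2 * (f x - g x)\<^sup>2 + 2 * (g x - h x)\<^sup>2 \<partial>N)"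
    using int by (intro integral_mono) auto
  also have "\<dots> = 2 * (\<integral>x. (f x - g x)\<^sup>2 \<partial>N) + 2 * (\<integral>x. (g x - h x)\<^sup>2 \<partial>N)"
    using int by simp
  finally show ?thesis .
qed

text \<open>By Fubini, convergence in \<open>L\<^sup>2\<close> of the product says that the squared \<open>L\<^sup>2(N)\<close>-errors of the sections
  converge to \<open>0\<close> in \<open>L\<^sup>1(M)\<close>, hence almost everywhere along a subsequence.\<close>

lemma L2_converges_pair_AE_subseq:
  fixes f :: "nat \<Rightarrow> 'a \<Rightarrow> 'b \<Rightarrow> real"
  assumes "pair_sigma_finite M N"
    and conv: "L2_converges (M \<Otimes>\<^sub>M N) (\<lambda>n (x, y). f n x y) (\<lambda>(x, y). g x y)"
  shows "\<exists>r. strict_mono r \<and> (AE x in M. (\<forall>n. f n x \<in> L2_space N) \<and> g x \<in> L2_space N \<and>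
    (\<lambda>n. \<integral>y. (g x y - f (r n) x y)\<^sup>2 \<partial>N) \<longlonglongrightarrow> 0)"
proof -
  interpret pair_sigma_finite M N by fact
  have slice: "AE x in M. h x \<in> L2_space N"
    if "(\<lambda>(x, y). h x y) \<in> L2_space (M \<Otimes>\<^sub>M N)" for h
  proof -
    have h: "(\<lambda>(x, y). h x y) \<in> borel_measurable (M \<Otimes>\<^sub>M N)"
      and "integrable (M \<Otimes>\<^sub>M N) (\<lambda>(x, y). (h x y)\<^sup>2)"
      using that by (auto simp: L2_space_def case_prod_unfold)
    from AE_integrable_fst[OF this(2)] AE_space show ?thesis
    proof eventually_elim
      case (elim x)
      then show ?case
        using measurable_Pair2[OF h, of x] by (simp add: L2_space_def)
    qed
  qed
  have fg: "(\<lambda>(x, y). f n x y) \<in> L2_space (M \<Otimes>\<^sub>M N)" "(\<lambda>(x, y). g x y) \<in> L2_space (M \<Otimes>\<^sub>M N)" for n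
    using conv by (auto simp: L2_converges_def)
  have int: "integrable (M \<Otimes>\<^sub>M N) (\<lambda>(x, y). (g x y - f n x y)\<^sup>2)" for n
    using integrable_L2_space_diff_square[OF fg(2) fg(1)[of n]] by (simp add: case_prod_unfold)
  let ?E = "\<lambda>n x. \<integral>y. (g x y - f n x y)\<^sup>2 \<partial>N"
  have "(\<lambda>n. sqrt (\<integral>x. norm (?E n x) \<partial>M)) \<longlonglongrightarrow> 0"
  proof -
    have "(\<integral>x. norm (?E n x) \<partial>M) = (\<integral>p. (case p of (x, y) \<Rightarrow> (g x y - f n x y)\<^sup>2) \<partial>(M \<Otimes>\<^sub>M N))" for n
      using integral_fst[OF int[of n]] by simp
    then show ?thesis
      using conv by (simp add: L2_converges_def L2_norm_def case_prod_unfold)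
  qed
  then have "(\<lambda>n. (sqrt (\<integral>x. norm (?E n x) \<partial>M))\<^sup>2) \<longlonglongrightarrow> 0\<^sup>2"
    by (intro tendsto_intros)
  then have "(\<lambda>n. \<integral>x. norm (?E n x) \<partial>M) \<longlonglongrightarrow> 0"
    by simp
  from tendsto_L1_AE_subseq[OF integrable_fst[OF int] this]
  obtain r where r: "strict_mono r" "AE x in M. (\<lambda>n. ?E (r n) x) \<longlonglongrightarrow> 0"
    by blast
  have "AE x in M. \<forall>n. f n x \<in> L2_space N"
    using slice[OF fg(1)] by (simp add: AE_all_countable)
  moreover note slice[OF fg(2)] r(2)
  ultimately have "AE x in M. (\<forall>n. f n x \<in> L2_space N) \<and> g x \<in> L2_space N \<and> (\<lambda>n. ?E (r n) x) \<longlonglongrightarrow> 0"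
    by eventually_elim simp
  with r(1) show ?thesis by blast
qed

section \<open>Almost sure summability and decay of the tail\<close>

text \<open>By monotone convergence the sum has a finite integral, so it is finite almost everywhere.\<close>

lemma AE_summable_of_summable_integral:
  fixes f :: "nat \<Rightarrow> 'a \<Rightarrow> real"
  assumes int: "\<And>n. integrable M (f n)" and nonneg: "\<And>n x. 0 \<le> f n x"
    and sum: "summable (\<lambda>n. \<integral>x. f n x \<partial>M)"
  shows "AE x in M. summable (\<lambda>n. f n x)"
proof -
  have [measurable]: "f n \<in> borel_measurable M" for n
    using int by auto
  have "(\<integral>\<^sup>+x. (\<Sum>n. ennreal (f n x)) \<partial>M) = (\<Sum>n. ennreal (\<integral>x. f n x \<partial>M))"
    by (subst nn_integral_suminf) (simp_all add: nn_integral_eq_integral int nonneg)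
  also have "\<dots> \<noteq> \<infinity>"
    using sum by (subst suminf_ennreal2) (simp_all add: nonneg)
  finally have "AE x in M. (\<Sum>n. ennreal (f n x)) \<noteq> \<infinity>"
    by (intro nn_integral_PInf_AE) simp_all
  then show ?thesis
    by eventually_elim (use nonneg in \<open>auto intro: summable_suminf_not_top\<close>)
qed

lemma std_normal_second_moment:
  assumes "distributed M lborel X (\<lambda>x. ennreal (std_normal_density x))"
  shows "integrable M (\<lambda>\<omega>. (X \<omega>)\<^sup>2)" "(\<integral>\<omega>. (X \<omega>)\<^sup>2 \<partial>M) = 1"
proof -
  have "integrable lborel (\<lambda>x. std_normal_density x * x\<^sup>2)"
    and "(\<integral>x. std_normal_density x * x\<^sup>2 \<partial>lborel) = 1"
    using std_normal_moment_even[of 1] by (auto simp: has_bochner_integral_iff numeral_2_eq_2)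
  then show "integrable M (\<lambda>\<omega>. (X \<omega>)\<^sup>2)" "(\<integral>\<omega>. (X \<omega>)\<^sup>2 \<partial>M) = 1"
    using distributed_integrable[OF assms, of "\<lambda>x. x\<^sup>2"] distributed_integral[OF assms, of "\<lambda>x. x\<^sup>2"]
    by simp_all
qed

lemma degree_energy_expectation:
  assumes "independent_std_normals M X1 X2"
  shows "integrable M (degree_energy X1 X2 l)" "(\<integral>\<omega>. degree_energy X1 X2 l \<omega> \<partial>M) = 2 * real l + 1"
proof -
  have "distributed M lborel (kl_coeff X1 X2 l k) (\<lambda>x. ennreal (std_normal_density x))"
    if "k \<in> {-int l..int l}" for k
    using assms that by (auto simp: independent_std_normals_def kl_coeff_def nat_le_iff)
  note coeff = std_normal_second_moment[OF this]
  show "integrable M (degree_energy X1 X2 l)"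
    unfolding degree_energy_def by (intro Bochner_Integration.integrable_sum coeff)
  show "(\<integral>\<omega>. degree_energy X1 X2 l \<omega> \<partial>M) = 2 * real l + 1"
    unfolding degree_energy_def by (subst Bochner_Integration.integral_sum) (simp_all add: coeff)
qed

lemma degree_energy_nonneg: "0 \<le> degree_energy X1 X2 l \<omega>"
  by (simp add: degree_energy_def sum_nonneg)

text \<open>This is where the decay of the spectrum enters. The energy in degree \<open>l\<close> has mean \<open>2l + 1\<close>, so the
  means of the terms are bounded by a multiple of \<open>l\<^bsup>2\<beta> + 1 - \<alpha>\<^esup>\<close> for large \<open>l\<close>, and these powers are
  summable exactly for \<open>\<beta> < (\<alpha> - 2) / 2\<close>.\<close>

lemma AE_summable_weighted_energy:
  assumes normals: "independent_std_normals M X1 X2"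
    and A: "\<And>l. A l \<ge> 0" "\<And>l. l > l0 \<Longrightarrow> A l \<le> C * real l powr (-\<alpha>)"
    and \<beta>: "\<beta> < (\<alpha> - 2) / 2"
  shows "AE \<omega> in M. summable (\<lambda>l. real l powr (2 * \<beta>) * (A l * degree_energy X1 X2 l \<omega>))"
proof (rule AE_summable_of_summable_integral)
  show "integrable M (\<lambda>\<omega>. real l powr (2 * \<beta>) * (A l * degree_energy X1 X2 l \<omega>))" for l
    using degree_energy_expectation(1)[OF normals] by simp
  show "0 \<le> real l powr (2 * \<beta>) * (A l * degree_energy X1 X2 l \<omega>)" for l \<omega>
    by (simp add: A degree_energy_nonneg)
  have "summable (\<lambda>l. 3 * C * real l powr (2 * \<beta> + 1 - \<alpha>))"
    using \<beta> by (intro summable_mult) (simp add: summable_real_powr_iff)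
  moreover have "norm (real l powr (2 * \<beta>) * (A l * (2 * real l + 1))) \<le> 3 * C * real l powr (2 * \<beta> + 1 - \<alpha>)"
    if "l \<ge> Suc l0" for l
  proof -
    \<comment> \<open>As \<open>l \<ge> 1\<close> here, \<open>2 l + 1 \<le> 3 l\<close>.\<close>
    have "real l powr (2 * \<beta>) * (A l * (2 * real l + 1)) \<le> real l powr (2 * \<beta>) * ((C * real l powr (-\<alpha>)) * (3 * real l))"
      using that A(1)[of l] by (intro mult_left_mono mult_mono A(2)) (auto intro: order.trans[OF A(1) A(2)])
    also have "\<dots> = 3 * C * real l powr (2 * \<beta> + 1 - \<alpha>)"
      using that by (simp add: powr_add powr_diff powr_minus field_simps)
    finally show ?thesis using A(1)[of l] by simp
  qed
  ultimately have "summable (\<lambda>l. real l powr (2 * \<beta>) * (A l * (2 * real l + 1)))"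
    by (rule summable_comparison_test')
  then show "summable (\<lambda>l. \<integral>\<omega>. real l powr (2 * \<beta>) * (A l * degree_energy X1 X2 l \<omega>) \<partial>M)"
    by (simp add: degree_energy_expectation[OF normals])
qed

lemma suminf_tail_tendsto_0:
  fixes a :: "nat \<Rightarrow> real"
  assumes "summable a"
  shows "(\<lambda>n. \<Sum>l. a (l + Suc n)) \<longlonglongrightarrow> 0"
proof -
  have "(\<lambda>n. suminf a - sum a {..<Suc n}) \<longlonglongrightarrow> suminf a - suminf a"
    using summable_LIMSEQ[OF assms] by (intro tendsto_diff tendsto_const LIMSEQ_Suc)
  then show ?thesis
    unfolding suminf_minus_initial_segment[OF assms] by simp
qed

text \<open>For \<open>l > \<kappa>\<close> the weight \<open>l\<^bsup>2\<beta>\<^esup>\<close> is at least \<open>\<kappa>\<^bsup>2\<beta>\<^esup>\<close>, so \<open>\<kappa>\<^bsup>2\<beta>\<^esup>\<close> times the tail of the series is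
  bounded by the tail of the weighted series, which tends to \<open>0\<close>. Any constant in front of the tail
  is thus absorbed; the \<open>2\<close> is the one of the lemma below.\<close>

lemma weighted_summable_tail:
  fixes a :: "nat \<Rightarrow> real"
  assumes a: "\<And>l. 0 \<le> a l" and \<beta>: "0 \<le> \<beta>"
    and sum: "summable (\<lambda>l. real l powr (2 * \<beta>) * a l)"
  shows "summable a" "\<forall>\<^sub>F \<kappa> in sequentially. 2 * (\<Sum>l. a (l + Suc \<kappa>)) \<le> real \<kappa> powr (- 2 * \<beta>)"
proof -
  let ?b = "\<lambda>l. real l powr (2 * \<beta>) * a l"
  have one: "1 \<le> real l powr (2 * \<beta>)" if "l \<ge> 1" for l
    using that \<beta> by (intro ge_one_powr_ge_zero) auto
  show "summable a"
  proof (rule summable_comparison_test'[OF sum])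
    show "norm (a l) \<le> ?b l" if "l \<ge> 1" for l
      using mult_right_mono[OF one[OF that] a[of l]] a[of l] by simp
  qed
  then have sa: "summable (\<lambda>l. a (l + Suc \<kappa>))" for \<kappa>
    by (subst summable_iff_shift)
  have sb: "summable (\<lambda>l. ?b (l + Suc \<kappa>))" for \<kappa>
    using sum by (subst summable_iff_shift)
  \<comment> \<open>The tail need only be at most \<open>1 / 2\<close>, which cancels the factor \<open>2\<close>.\<close>
  have "\<forall>\<^sub>F \<kappa> in sequentially. (\<Sum>l. ?b (l + Suc \<kappa>)) < 1 / 2"
    using suminf_tail_tendsto_0[OF sum] by (rule order_tendstoD) simp
  moreover have "\<forall>\<^sub>F \<kappa> in sequentially. \<kappa> \<ge> (1::nat)"
    by (rule eventually_ge_at_top)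
  ultimately show "\<forall>\<^sub>F \<kappa> in sequentially. 2 * (\<Sum>l. a (l + Suc \<kappa>)) \<le> real \<kappa> powr (- 2 * \<beta>)"
  proof eventually_elim
    case (elim \<kappa>)
    have "real \<kappa> powr (2 * \<beta>) * (\<Sum>l. a (l + Suc \<kappa>)) = (\<Sum>l. real \<kappa> powr (2 * \<beta>) * a (l + Suc \<kappa>))"
      using sa by (simp only: suminf_mult)
    also have "\<dots> \<le> (\<Sum>l. ?b (l + Suc \<kappa>))"
      using \<beta> a by (intro suminf_le mult_right_mono powr_mono2 summable_mult sa sb) auto
    also have "\<dots> \<le> 1 / 2"
      using elim by simp
    finally show ?case
      using elim by (simp add: powr_minus field_simps)
  qed
qed

section \<open>Rate of convergence of the truncated field\<close>

text \<open>The limit \<open>g\<close> is known only along the subsequence \<open>r\<close>. Compare the truncation at \<open>\<kappa>\<close> with the one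
  at \<open>r n\<close>: by Parseval their squared distance is a partial sum of the tail, whatever \<open>n\<close> is, and
  the distance from the latter to \<open>g\<close> vanishes as \<open>n\<close> grows.\<close>

lemma truncation_error_le_tail:
  assumes A: "\<And>l. A l \<ge> 0"
    and L2: "\<And>n. truncated_field A X1 X2 n \<omega> \<in> L2_space S2_measure" "g \<in> L2_space S2_measure"
    and r: "strict_mono r" "(\<lambda>n. \<integral>y. (g y - truncated_field A X1 X2 (r n) \<omega> y)\<^sup>2 \<partial>S2_measure) \<longlonglongrightarrow> 0"
    and sum: "summable (\<lambda>l. A l * degree_energy X1 X2 l \<omega>)"
  shows "(\<integral>y. (g y - truncated_field A X1 X2 \<kappa> \<omega> y)\<^sup>2 \<partial>S2_measure)
    \<le> 2 * (\<Sum>l. A (l + Suc \<kappa>) * degree_energy X1 X2 (l + Suc \<kappa>) \<omega>)"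
proof -
  let ?a = "\<lambda>l. A l * degree_energy X1 X2 l \<omega>"
  let ?t = "\<lambda>n. truncated_field A X1 X2 n \<omega>"
  let ?E = "\<lambda>n. \<integral>y. (g y - ?t n y)\<^sup>2 \<partial>S2_measure"
  have a: "0 \<le> ?a l" for l
    by (simp add: A degree_energy_nonneg)
  have meas: "?t n \<in> borel_measurable S2_measure" for n
    using L2(1) by (simp add: L2_space_def)
  have "?E \<kappa> \<le> 2 * ?E (r n) + 2 * (\<Sum>l. ?a (l + Suc \<kappa>))" if "n \<ge> \<kappa>" for n
  proof -
    have "\<kappa> \<le> r n"
      using that seq_suble[OF r(1), of n] by simp
    have "(\<Sum>l\<in>{\<kappa><..r n}. ?a l) = (\<Sum>l<r n - \<kappa>. ?a (l + Suc \<kappa>))"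
      by (rule sum.reindex_bij_witness[of _ "\<lambda>l. l + Suc \<kappa>" "\<lambda>l. l - Suc \<kappa>"]) auto
    also have "\<dots> \<le> (\<Sum>l. ?a (l + Suc \<kappa>))"
      using a sum by (intro sum_le_suminf) (subst summable_iff_shift, auto)
    finally have "(\<integral>y. (?t (r n) y - ?t \<kappa> y)\<^sup>2 \<partial>S2_measure) \<le> (\<Sum>l. ?a (l + Suc \<kappa>))"
      using truncated_field_diff_parseval[OF A \<open>\<kappa> \<le> r n\<close> meas meas] by simp
    then show ?thesis
      using L2_diff_square_triangle[OF L2(2) L2(1)[of "r n"] L2(1)[of \<kappa>]] by simp
  qed
  moreover have "(\<lambda>n. 2 * ?E (r n) + 2 * (\<Sum>l. ?a (l + Suc \<kappa>))) \<longlonglongrightarrow> 2 * 0 + 2 * (\<Sum>l. ?a (l + Suc \<kappa>))"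
    by (intro tendsto_intros r)
  ultimately show ?thesis
    by (intro LIMSEQ_le_const) auto
qed

theorem corollary5p4:
  fixes M :: "'a measure"
    and T :: "'a \<Rightarrow> real^3 \<Rightarrow> real"
    and A :: "nat \<Rightarrow> real"
    and X1 X2 :: "nat \<Rightarrow> nat \<Rightarrow> 'a \<Rightarrow> real"
    and \<alpha> :: real
  assumes "prob_space M"
    and "centered_isotropic_gaussian_field M T"
    and "angular_power_spectrum M T A"
    and "karhunen_loeve_expansion M T A X1 X2"
    and "\<alpha> > 2"
    and "\<exists>C>0. \<exists>l0::nat. \<forall>l>l0. A l \<le> C * real l powr (-\<alpha>)"
  shows "(AE \<omega> in M. L2_converges S2_measure (\<lambda>\<kappa>. truncated_field A X1 X2 \<kappa> \<omega>) (T \<omega>)) \<and>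
    (\<forall>\<beta> < (\<alpha> - 2) / 2. AE \<omega> in M. \<forall>\<^sub>F \<kappa> in sequentially.
       L2_norm S2_measure (\<lambda>y. T \<omega> y - truncated_field A X1 X2 \<kappa> \<omega> y) \<le> real \<kappa> powr (-\<beta>))"
proof -
  interpret prob_space M by fact
  interpret S2: finite_measure S2_measure by (rule finite_measure_S2_measure)
  interpret pair_sigma_finite M S2_measure ..
  let ?E = "\<lambda>\<kappa> \<omega>. \<integral>y. (T \<omega> y - truncated_field A X1 X2 \<kappa> \<omega> y)\<^sup>2 \<partial>S2_measure"
  let ?a = "\<lambda>\<omega> l. A l * degree_energy X1 X2 l \<omega>"
  have A: "A l \<ge> 0" for l
    using assms(3) by (simp add: angular_power_spectrum_def)
  obtain C l0 where C: "\<And>l. l > l0 \<Longrightarrow> A l \<le> C * real l powr (-\<alpha>)"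
    using assms(6) by blast
  have normals: "independent_std_normals M X1 X2"
    and conv: "L2_converges (M \<Otimes>\<^sub>M S2_measure)
       (\<lambda>\<kappa> (\<omega>, y). truncated_field A X1 X2 \<kappa> \<omega> y) (\<lambda>(\<omega>, y). T \<omega> y)"
    using assms(4) by (simp_all add: karhunen_loeve_expansion_def)
  obtain r where r: "strict_mono r" "AE \<omega> in M. (\<forall>n. truncated_field A X1 X2 n \<omega> \<in> L2_space S2_measure) \<and>
      T \<omega> \<in> L2_space S2_measure \<and> (\<lambda>n. ?E (r n) \<omega>) \<longlonglongrightarrow> 0"
    using L2_converges_pair_AE_subseq[OF pair_sigma_finite_axioms conv] by blast
  have a: "0 \<le> ?a \<omega> l" for \<omega> l
    by (simp add: A degree_energy_nonneg)
  have weighted: "AE \<omega> in M. summable (\<lambda>l. real l powr (2 * \<beta>) * ?a \<omega> l)" if "\<beta> < (\<alpha> - 2) / 2" for \<beta>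
    using AE_summable_weighted_energy[OF normals A C that] .
  have conv_AE: "AE \<omega> in M. L2_converges S2_measure (\<lambda>\<kappa>. truncated_field A X1 X2 \<kappa> \<omega>) (T \<omega>)"
  proof -
    have "0 < (\<alpha> - 2) / 2" using assms(5) by simp
    from weighted[OF this] r(2) show ?thesis
    proof eventually_elim
      case (elim \<omega>)
      \<comment> \<open>The weighted series at exponent \<open>0\<close> is the plain one, up to its term at \<open>l = 0\<close>.\<close>
      then have sum: "summable (?a \<omega>)"
        using weighted_summable_tail(1)[of "?a \<omega>" 0] a by simp
      have "(\<lambda>\<kappa>. 2 * (\<Sum>l. ?a \<omega> (l + Suc \<kappa>))) \<longlonglongrightarrow> 2 * 0"
        by (intro tendsto_intros suminf_tail_tendsto_0 sum)
      then have upper: "(\<lambda>\<kappa>. 2 * (\<Sum>l. ?a \<omega> (l + Suc \<kappa>))) \<longlonglongrightarrow> 0"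
        by simp
      have "(\<lambda>\<kappa>. ?E \<kappa> \<omega>) \<longlonglongrightarrow> 0"
      proof (rule tendsto_sandwich[OF _ _ tendsto_const upper])
        show "\<forall>\<^sub>F \<kappa> in sequentially. 0 \<le> ?E \<kappa> \<omega>"
          by (intro always_eventually allI integral_nonneg_AE) simp
        show "\<forall>\<^sub>F \<kappa> in sequentially. ?E \<kappa> \<omega> \<le> 2 * (\<Sum>l. ?a \<omega> (l + Suc \<kappa>))"
          using elim(2) by (intro always_eventually allI truncation_error_le_tail[OF A _ _ r(1) _ sum]) blast+
      qed
      then have "(\<lambda>\<kappa>. sqrt (?E \<kappa> \<omega>)) \<longlonglongrightarrow> sqrt 0"
        by (intro tendsto_intros)
      with elim show ?case
        by (simp add: L2_converges_def L2_norm_def)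
    qed
  qed
  have rate: "AE \<omega> in M. \<forall>\<^sub>F \<kappa> in sequentially.
       L2_norm S2_measure (\<lambda>y. T \<omega> y - truncated_field A X1 X2 \<kappa> \<omega> y) \<le> real \<kappa> powr (-\<beta>)"
    if "\<beta> < (\<alpha> - 2) / 2" for \<beta>
  proof -
    \<comment> \<open>The comparison of the weights needs a nonnegative exponent; a negative \<open>\<beta>\<close> only weakens the claim.\<close>
    define \<gamma> where "\<gamma> = max \<beta> 0"
    have \<gamma>: "\<gamma> < (\<alpha> - 2) / 2" "0 \<le> \<gamma>" "\<beta> \<le> \<gamma>"
      using that assms(5) by (auto simp: \<gamma>_def)
    from weighted[OF \<gamma>(1)] r(2) show ?thesis
    proof eventually_elim
      case (elim \<omega>)
      note tail = weighted_summable_tail[OF a \<gamma>(2) elim(1)]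
      have le_tail: "?E \<kappa> \<omega> \<le> 2 * (\<Sum>l. ?a \<omega> (l + Suc \<kappa>))" for \<kappa>
        using elim(2) by (intro truncation_error_le_tail[OF A _ _ r(1) _ tail(1)]) blast+
      from tail(2) eventually_ge_at_top[of "1 :: nat"] show ?case
      proof eventually_elim
        case (elim \<kappa>)
        have "?E \<kappa> \<omega> \<le> 2 * (\<Sum>l. ?a \<omega> (l + Suc \<kappa>))"
          by (rule le_tail)
        also have "\<dots> \<le> real \<kappa> powr (- 2 * \<gamma>)"
          by (rule elim)
        also have "\<dots> = (real \<kappa> powr (- \<gamma>))\<^sup>2"
          using elim by (simp add: power2_eq_square flip: powr_add)
        finally have "sqrt (?E \<kappa> \<omega>) \<le> real \<kappa> powr (- \<gamma>)"
          by (rule real_le_lsqrt[rotated]) simp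
        also have "\<dots> \<le> real \<kappa> powr (- \<beta>)"
          using elim \<gamma>(3) by (intro powr_mono) auto
        finally show ?case
          by (simp add: L2_norm_def)
      qed
    qed
  qed
  from conv_AE rate show ?thesis by blast
qed

end
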